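(* Let $n\ge 2$, $0<\alpha<n$, let $\mu$ be a finite (nonnegative) Borel measure on $\mathbb{R}^n$, and define $$I_\alpha\mu(x)=\int_{\mathbb{R}^n}\frac{d\mu(y)}{|x-y|^{n-\alpha}}.$$ Then $(I_\alpha\mu)^r\in A_1$ for all $0\le r<\left(\frac n\alpha\right)'=\frac{n}{n-\alpha}$.
   Context: A weight $w$ belongs to $A_1$ if there is a constant $C$ with $Mw\le Cw$ almost everywhere, where $Mw(x)=\sup_{Q\ni x}\frac1{|Q|}\int_Q|w|$ is the Hardy–Littlewood maximal function over cubes $Q$ with sides parallel to the axes. *)

theory Defs
  imports "HOL-Analysis.Analysis"
begin

(* All functions here take values in [0, \<infinity>]: the potential of a measure may be infinite
   at some points. *)

(* For exponents r \<ge> 0 only. The case r = 0 is separated because 0 powr 0 = 0 in the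
   library, whereas the zeroth power of a weight is the constant 1. *)
definition ennreal_rpow :: "ennreal \<Rightarrow> real \<Rightarrow> ennreal" where
  "ennreal_rpow a r =
     (if r = 0 then 1 else if a = \<infinity> then \<infinity> else ennreal (enn2real a powr r))"

(* The kernel is formed by division in ennreal, where 1 / 0 = \<infinity>; it is therefore
   infinite on the diagonal, so that the potential is infinite at the atoms of \<mu>. *)
definition riesz_potential :: "real \<Rightarrow> (real ^ 'n) measure \<Rightarrow> real ^ 'n \<Rightarrow> ennreal" where
  "riesz_potential \<alpha> \<mu> x =
     (\<integral>\<^sup>+ y. 1 / ennreal (norm (x - y) powr (real CARD('n) - \<alpha>)) \<partial>\<mu>)"

definition cubes :: "(real ^ 'n) set set" where
  "cubes = {cbox a (\<chi> i. a $ i + l) | a l. l > 0}"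

definition hl_maximal :: "(real ^ 'n \<Rightarrow> ennreal) \<Rightarrow> real ^ 'n \<Rightarrow> ennreal" where
  "hl_maximal w x =
     (SUP Q \<in> {Q \<in> cubes. x \<in> Q}. (\<integral>\<^sup>+ y \<in> Q. w y \<partial>lebesgue) / emeasure lebesgue Q)"

(* Nonnegative and locally integrable (hence finite almost everywhere). Positivity is not
   required: the zero function counts as a weight. *)
definition weight :: "(real ^ 'n \<Rightarrow> ennreal) \<Rightarrow> bool" where
  "weight w \<longleftrightarrow> w \<in> borel_measurable lebesgue \<and>
     (\<forall>K. compact K \<longrightarrow> (\<integral>\<^sup>+ y \<in> K. w y \<partial>lebesgue) < \<infinity>)"

definition A1 :: "(real ^ 'n \<Rightarrow> ennreal) set" where
  "A1 = {w. weight w \<and>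
     (\<exists>C::real. AE x in lebesgue. hl_maximal w x \<le> ennreal C * w x)}"

end

theory Submission
  imports Defs
begin

text \<open>
  Write \<open>n\<close> for the dimension, \<open>s = n - \<alpha>\<close>, \<open>k\<^sub>t(z) = 1 / |z|\<^sup>t\<close> and \<open>I\<close> for the Riesz potential
  of \<open>\<mu>\<close>, so that \<open>I(x)\<close> is the integral of \<open>k\<^sub>s(x - y)\<close> against \<open>d\<mu>(y)\<close>. The condition on \<open>r\<close>
  says exactly that \<open>t = s r < n\<close>, which is the range in which \<open>k\<^sub>t\<close> is locally integrable and,
  by homogeneity, an \<open>A\<^sub>1\<close> weight: the average of \<open>k\<^sub>t(z - y)\<close> over \<open>z\<close> in a cube \<open>Q\<close> is at most
  \<open>C k\<^sub>t(x - y)\<close> for every \<open>x\<close> in \<open>Q\<close>, with \<open>C\<close> independent of the pole \<open>y\<close>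
  (\<open>riesz_kernel_cube_average\<close>).

  This estimate passes to \<open>I\<^sup>r\<close>. Let \<open>r \<ge> 1\<close>, fix a cube \<open>Q\<close> and a point \<open>x\<close> in \<open>Q\<close> with
  \<open>I(x) < \<infinity>\<close>, and put \<open>d\<nu>(y) = k\<^sub>s(x - y) d\<mu>(y)\<close>, a measure of total mass \<open>I(x)\<close>. For each \<open>z\<close>,
  the value \<open>I(z)\<close> is the integral of \<open>|x - y|\<^sup>s k\<^sub>s(z - y)\<close> against \<open>d\<nu>(y)\<close>, so Jensen's inequality
  (\<open>rpow_nn_integral_le\<close>) bounds \<open>I(z)\<^sup>r\<close> by \<open>I(x)\<^bsup>r-1\<^esup>\<close> times the \<open>\<nu>\<close>-integral of
  \<open>|x - y|\<^sup>t k\<^sub>t(z - y)\<close>. After averaging over \<open>z\<close> in \<open>Q\<close>, this integrand is at most \<open>C\<close> for every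
  \<open>y\<close>, and what remains is \<open>C I(x)\<^bsup>r-1\<^esup> \<nu>(\<real>\<^sup>n) = C I(x)\<^sup>r\<close> (\<open>riesz_potential_rpow_A1\<close>).

  For \<open>r < 1\<close> the claim follows from the case of exponent 1, because \<open>A\<^sub>1\<close> is closed under powers
  with exponent in \<open>[0, 1]\<close> (\<open>A1_rpow_le_1\<close>).
\<close>

section \<open>Powers of extended nonnegative numbers and the Riesz kernel\<close>

text \<open>
  As in the definition of the potential, the division is in \<open>ennreal\<close>: the kernel is infinite at
  the origin.
\<close>

definition riesz_kernel :: "real \<Rightarrow> 'a::real_normed_vector \<Rightarrow> ennreal" where
  "riesz_kernel t z = 1 / ennreal (norm z powr t)"

lemma riesz_kernel_eq: "z \<noteq> 0 \<Longrightarrow> riesz_kernel t z = ennreal (norm z powr (- t))"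
  unfolding riesz_kernel_def by (simp add: divide_ennreal[of 1, simplified] powr_minus_divide)

lemma riesz_kernel_0: "riesz_kernel t 0 = top"
  by (simp add: riesz_kernel_def)

lemma measurable_riesz_kernel [measurable]:
  "riesz_kernel t \<in> borel_measurable (borel :: 'a::euclidean_space measure)"
  unfolding riesz_kernel_def by measurable

lemma riesz_kernel_antimono:
  assumes "0 < d" "d \<le> norm z" "0 \<le> t"
  shows "riesz_kernel t z \<le> ennreal (d powr (- t))"
proof -
  have "z \<noteq> 0" using assms by auto
  then show ?thesis
    using assms by (auto simp: riesz_kernel_eq intro!: ennreal_leI powr_mono2')
qed

lemma rpow_ennreal: "r \<noteq> 0 \<Longrightarrow> 0 \<le> a \<Longrightarrow> ennreal_rpow (ennreal a) r = ennreal (a powr r)"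
  unfolding ennreal_rpow_def by simp

lemma rpow_top: "r \<noteq> 0 \<Longrightarrow> ennreal_rpow top r = top"
  unfolding ennreal_rpow_def by simp

lemma rpow_0: "r \<noteq> 0 \<Longrightarrow> ennreal_rpow 0 r = 0"
  unfolding ennreal_rpow_def by simp

lemma rpow_1 [simp]: "ennreal_rpow a 1 = a"
  unfolding ennreal_rpow_def by (auto simp: less_top)

lemma measurable_rpow [measurable]: "(\<lambda>a. ennreal_rpow a r) \<in> borel_measurable borel"
  unfolding ennreal_rpow_def by measurable

lemma rpow_ennreal_mult:
  assumes "0 < r" "0 < c"
  shows "ennreal_rpow (ennreal c * a) r = ennreal (c powr r) * ennreal_rpow a r"
proof (cases a)
  case (real x)
  then show ?thesis using assms
    by (simp add: ennreal_mult[symmetric] rpow_ennreal powr_mult)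
next
  case top
  then show ?thesis using assms rpow_top[of r] by (simp add: ennreal_mult_top)
qed

lemma rpow_diff_mult:
  assumes "1 \<le> r" "a < \<infinity>"
  shows "ennreal_rpow a (r - 1) * a = ennreal_rpow a r"
proof (cases a)
  case (real x)
  show ?thesis
  proof (cases "r = 1")
    case True then show ?thesis by (simp add: ennreal_rpow_def[of a 0])
  next
    case False
    have "x powr (r - 1) * x = x powr r"
      using real by (cases "x = 0") (auto simp: powr_diff)
    then show ?thesis using real assms False by (simp add: rpow_ennreal ennreal_mult[symmetric])
  qed
next
  case top then show ?thesis using assms by simp
qed

lemma rpow_riesz_kernel:
  assumes "0 < r"
  shows "ennreal_rpow (riesz_kernel s z) r = riesz_kernel (s * r) z"
  using assms by (cases "z = 0")
    (auto simp: riesz_kernel_0 rpow_top rpow_ennreal riesz_kernel_eq powr_powr)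

section \<open>Averages of the Riesz kernel over cubes\<close>

text \<open>
  Cut the ball into the dyadic shells \<open>\<rho> / 2\<^bsup>k+1\<^esup> < |z - y| \<le> \<rho> / 2\<^sup>k\<close>. On each of them the kernel
  is comparable to a constant, and the contributions form a geometric series with ratio
  \<open>2\<^bsup>t-n\<^esup>\<close>, which is less than 1 because \<open>t < n\<close>.
\<close>
lemma riesz_kernel_integral_ball:
  fixes t :: real
  assumes t: "0 < t" "t < real DIM('a)"
  shows "\<exists>C>0. \<forall>(y::'a::euclidean_space) \<rho>. 0 < \<rho> \<longrightarrow>
    (\<integral>\<^sup>+ z \<in> cball y \<rho>. riesz_kernel t (z - y) \<partial>lborel)
      \<le> ennreal (C * \<rho> powr (real DIM('a) - t))"
proof -
  define n where "n = real DIM('a)"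
  define q where "q = 2 powr (t - n)"
  define V where "V = unit_ball_vol (real DIM('a))"
  have q: "0 < q" "q < 1" unfolding q_def n_def using t powr_less_one[of 2 "t - real DIM('a)"] by auto
  have V: "0 < V" unfolding V_def by simp
  define C where "C = V * 2 powr t / (1 - q)"
  have "(\<integral>\<^sup>+ z \<in> cball y \<rho>. riesz_kernel t (z - y) \<partial>lborel) \<le> ennreal (C * \<rho> powr (n - t))"
    if \<rho>: "0 < \<rho>" for y :: 'a and \<rho>
  proof -
    \<comment> \<open>The constant belongs to the inner radius of a shell; replacing the shell by the full ball
        costs only a constant factor in the sum and makes the volume explicit.\<close>
    define c where "c k = (\<rho> / 2 ^ Suc k) powr (- t)" for k :: nat
    have [measurable]: "cball y d \<in> sets borel" for d by simp
    have pointwise: "riesz_kernel t (z - y) * indicator (cball y \<rho>) z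
        \<le> (\<Sum>k. ennreal (c k) * indicator (cball y (\<rho> / 2 ^ k)) z)" if "z \<noteq> y" for z
    proof (cases "z \<in> cball y \<rho>")
      case True
      define d where "d = norm (z - y)"
      have d: "0 < d" "d \<le> \<rho>" using that True
        by (auto simp: d_def dist_norm norm_minus_commute)
      have ex: "\<exists>k. \<rho> / 2 ^ k < d"
        using real_arch_pow_inv[of "d / \<rho>" "1/2"] d \<rho> by (auto simp: field_simps power_divide)
      define m where "m = (LEAST k. \<rho> / 2 ^ k < d)"
      have m: "\<rho> / 2 ^ m < d" unfolding m_def using ex by (rule LeastI_ex)
      have "m \<noteq> 0" using m d by (cases m) auto
      then obtain j where j: "m = Suc j" using not0_implies_Suc by blast
      have "\<not> \<rho> / 2 ^ j < d" using not_less_Least[of j "\<lambda>k. \<rho> / 2 ^ k < d"] j m_def by simp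
      then have zj: "z \<in> cball y (\<rho> / 2 ^ j)" by (simp add: d_def dist_norm norm_minus_commute)
      have "riesz_kernel t (z - y) \<le> ennreal (c j)"
        unfolding c_def using m j t \<rho> by (intro riesz_kernel_antimono) (auto simp: d_def)
      also have "\<dots> = (\<Sum>k\<in>{j}. ennreal (c k) * indicator (cball y (\<rho> / 2 ^ k)) z)"
        using zj by simp
      also have "\<dots> \<le> (\<Sum>k. ennreal (c k) * indicator (cball y (\<rho> / 2 ^ k)) z)"
        by (intro sum_le_suminf) auto
      finally show ?thesis using True by simp
    qed simp
    have shell: "c k * (V * (\<rho> / 2 ^ k) ^ DIM('a)) = V * 2 powr t * \<rho> powr (n - t) * q ^ k" for k
    proof -
      have c: "c k = \<rho> powr (- t) * 2 powr (t * (real k + 1))"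
        unfolding c_def using \<rho>
        by (simp add: powr_divide powr_realpow[symmetric] powr_powr powr_minus
            powr_add[symmetric] divide_simps del: power_Suc) (simp add: algebra_simps flip: powr_add)
      have b: "(\<rho> / 2 ^ k) ^ DIM('a) = \<rho> powr n * 2 powr (- (real k * n))"
        unfolding n_def using \<rho>
        by (simp add: power_divide powr_realpow[symmetric] powr_powr powr_minus_divide)
      have qk: "q ^ k = 2 powr ((t - n) * real k)"
        unfolding q_def by (simp add: powr_realpow[symmetric] powr_powr)
      have "c k * (V * (\<rho> / 2 ^ k) ^ DIM('a)) =
          V * (\<rho> powr (- t) * \<rho> powr n) * (2 powr (t * (real k + 1)) * 2 powr (- (real k * n)))"
        unfolding c b by (simp add: algebra_simps)
      also have "\<dots> = V * \<rho> powr (n - t) * (2 powr t * q ^ k)"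
        unfolding qk powr_add[symmetric] by (simp add: algebra_simps)
      finally show ?thesis by (simp only: mult_ac)
    qed
    have "(\<integral>\<^sup>+ z \<in> cball y \<rho>. riesz_kernel t (z - y) \<partial>lborel)
        \<le> (\<integral>\<^sup>+ z. (\<Sum>k. ennreal (c k) * indicator (cball y (\<rho> / 2 ^ k)) z) \<partial>lborel)"
      using AE_lborel_singleton[of y] by (intro nn_integral_mono_AE) (auto dest: pointwise)
    also have "\<dots> = (\<Sum>k. \<integral>\<^sup>+ z. ennreal (c k) * indicator (cball y (\<rho> / 2 ^ k)) z \<partial>lborel)"
      by (intro nn_integral_suminf) auto
    also have "\<dots> = (\<Sum>k. ennreal (V * 2 powr t * \<rho> powr (n - t) * q ^ k))"
    proof (rule suminf_cong)
      fix k
      have "(\<integral>\<^sup>+ z. ennreal (c k) * indicator (cball y (\<rho> / 2 ^ k)) z \<partial>lborel)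
          = ennreal (c k) * ennreal (V * (\<rho> / 2 ^ k) ^ DIM('a))"
        using \<rho> by (simp add: nn_integral_cmult_indicator emeasure_cball V_def del: power_divide)
      also have "\<dots> = ennreal (c k * (V * (\<rho> / 2 ^ k) ^ DIM('a)))"
        using \<rho> V by (intro ennreal_mult[symmetric]) (auto simp: c_def)
      finally show "(\<integral>\<^sup>+ z. ennreal (c k) * indicator (cball y (\<rho> / 2 ^ k)) z \<partial>lborel)
          = ennreal (V * 2 powr t * \<rho> powr (n - t) * q ^ k)" unfolding shell .
    qed
    also have "\<dots> = ennreal (V * 2 powr t * \<rho> powr (n - t) * (1 / (1 - q)))"
      using q V by (intro suminf_ennreal_eq sums_mult geometric_sums) auto
    also have "\<dots> = ennreal (C * \<rho> powr (n - t))" by (simp add: C_def field_simps)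
    finally show ?thesis .
  qed
  moreover have "0 < C" using q V by (simp add: C_def)
  ultimately show ?thesis unfolding n_def by blast
qed

text \<open>
  Off the ball of radius \<open>\<rho>\<close> about the pole the kernel is at most \<open>\<rho>\<^bsup>-t\<^esup>\<close>. The bound depends on \<open>E\<close>
  only through its measure, hence is uniform in the pole; it serves for the averages over cubes and
  for local integrability.
\<close>
lemma riesz_kernel_integral_set:
  fixes t :: real
  assumes t: "0 < t" "t < real DIM('a)"
  shows "\<exists>C>0. \<forall>(y::'a::euclidean_space) \<rho> E. 0 < \<rho> \<longrightarrow> E \<in> sets borel \<longrightarrow>
    (\<integral>\<^sup>+ z \<in> E. riesz_kernel t (z - y) \<partial>lborel)
      \<le> ennreal (C * \<rho> powr (real DIM('a) - t)) + ennreal (\<rho> powr (- t)) * emeasure lborel E"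
proof -
  obtain C where C: "C > 0" "\<And>(y::'a) \<rho>. 0 < \<rho> \<Longrightarrow>
      (\<integral>\<^sup>+ z \<in> cball y \<rho>. riesz_kernel t (z - y) \<partial>lborel)
        \<le> ennreal (C * \<rho> powr (real DIM('a) - t))"
    using riesz_kernel_integral_ball[where 'a='a, OF t] by blast
  have "(\<integral>\<^sup>+ z \<in> E. riesz_kernel t (z - y) \<partial>lborel)
      \<le> ennreal (C * \<rho> powr (real DIM('a) - t)) + ennreal (\<rho> powr (- t)) * emeasure lborel E"
    if \<rho>: "0 < \<rho>" and E[measurable]: "E \<in> sets borel" for y :: 'a and \<rho> E
  proof -
    have [measurable]: "cball y \<rho> \<in> sets borel" by simp
    have "riesz_kernel t (z - y) * indicator E z
        \<le> riesz_kernel t (z - y) * indicator (cball y \<rho>) z + ennreal (\<rho> powr (- t)) * indicator E z"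
      for z
      using riesz_kernel_antimono[of \<rho> "z - y" t] \<rho> t
      by (auto simp: indicator_def dist_norm norm_minus_commute)
    then have "(\<integral>\<^sup>+ z \<in> E. riesz_kernel t (z - y) \<partial>lborel)
      \<le> (\<integral>\<^sup>+ z. riesz_kernel t (z - y) * indicator (cball y \<rho>) z
            + ennreal (\<rho> powr (- t)) * indicator E z \<partial>lborel)"
      by (intro nn_integral_mono)
    also have "\<dots> = (\<integral>\<^sup>+ z \<in> cball y \<rho>. riesz_kernel t (z - y) \<partial>lborel)
        + ennreal (\<rho> powr (- t)) * emeasure lborel E"
      by (subst nn_integral_add) (auto simp: nn_integral_cmult_indicator)
    finally show ?thesis using C(2)[OF \<rho>, of y] by (meson add_right_mono order_trans)
  qed
  with C(1) show ?thesis by blast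
qed

lemma cubesE:
  assumes "Q \<in> (cubes :: (real ^ 'n) set set)"
  obtains l where "0 < l" "Q \<in> sets borel" "emeasure lborel Q = ennreal (l ^ CARD('n))"
    "\<And>x z. x \<in> Q \<Longrightarrow> z \<in> Q \<Longrightarrow> norm (x - z) \<le> real CARD('n) * l"
proof -
  from assms obtain a :: "real ^ 'n" and l where Q: "Q = cbox a (\<chi> i. a $ i + l)" and l: "0 < l"
    unfolding cubes_def by auto
  have ne: "Q \<noteq> {}" unfolding Q using l by (auto simp: interval_ne_empty_cart less_imp_le)
  have "measure lborel Q = l ^ CARD('n)"
    using ne unfolding Q by (simp add: content_cbox_cart)
  then have em: "emeasure lborel Q = ennreal (l ^ CARD('n))"
    using emeasure_lborel_cbox_finite[of a "\<chi> i. a $ i + l"]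
    by (subst emeasure_eq_ennreal_measure) (auto simp: Q)
  have "norm (x - z) \<le> real CARD('n) * l" if "x \<in> Q" "z \<in> Q" for x z
  proof -
    have "norm (x - z) \<le> (\<Sum>i\<in>UNIV. \<bar>(x - z) $ i\<bar>)" by (rule norm_le_l1_cart)
    also have "\<dots> \<le> (\<Sum>i\<in>(UNIV::'n set). l)"
    proof (rule sum_mono)
      fix i
      have "a $ i \<le> x $ i" "x $ i \<le> a $ i + l" "a $ i \<le> z $ i" "z $ i \<le> a $ i + l"
        using that unfolding Q by (auto simp: mem_box_cart)
      then show "\<bar>(x - z) $ i\<bar> \<le> l" by simp
    qed
    finally show ?thesis by simp
  qed
  with em l show ?thesis using that[of l] Q by auto
qed

text \<open>
  The translates of \<open>k\<^sub>t\<close> satisfy the \<open>A\<^sub>1\<close> condition with a common constant. Let \<open>l\<close> be the side of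
  \<open>Q\<close>. If \<open>|x - y|\<close> is at most a fixed multiple of \<open>l\<close>, the uniform bound above with \<open>\<rho> = l\<close>
  gives an average of order \<open>l\<^bsup>-t\<^esup>\<close>, which is at most a constant times \<open>|x - y|\<^bsup>-t\<^esup>\<close>. Otherwise \<open>y\<close> is so far
  from \<open>Q\<close> that \<open>|z - y| \<ge> |x - y| / 2\<close> on the whole cube.
\<close>
lemma riesz_kernel_cube_average:
  fixes t :: real
  assumes t: "0 < t" "t < real CARD('n)"
  shows "\<exists>C>0. \<forall>Q \<in> cubes. \<forall>x\<in>Q. \<forall>y :: real ^ 'n.
    (\<integral>\<^sup>+ z \<in> Q. riesz_kernel t (z - y) \<partial>lborel)
      \<le> ennreal C * emeasure lborel Q * riesz_kernel t (x - y)"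
proof -
  let ?n = "real CARD('n)"
  obtain K where K: "K > 0" "\<And>(y::real^'n) \<rho> E. 0 < \<rho> \<Longrightarrow> E \<in> sets borel \<Longrightarrow>
    (\<integral>\<^sup>+ z \<in> E. riesz_kernel t (z - y) \<partial>lborel)
      \<le> ennreal (K * \<rho> powr (?n - t)) + ennreal (\<rho> powr (- t)) * emeasure lborel E"
    using riesz_kernel_integral_set[where 'a = "real^'n", of t] t by auto
  \<comment> \<open>The first summand of the constant serves the case of a near pole, the second a far one.\<close>
  define C where "C = (K + 1) * (2 * ?n) powr t + 2 powr t"
  have "(\<integral>\<^sup>+ z \<in> Q. riesz_kernel t (z - y) \<partial>lborel)
      \<le> ennreal C * emeasure lborel Q * riesz_kernel t (x - y)"
    if Q: "Q \<in> cubes" and x: "x \<in> Q" for Q and x y :: "real^'n"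
  proof -
    obtain l where l: "0 < l" and Qm[measurable]: "Q \<in> sets borel"
      and em: "emeasure lborel Q = ennreal (l ^ CARD('n))"
      and diam: "\<And>x z. x \<in> Q \<Longrightarrow> z \<in> Q \<Longrightarrow> norm (x - z) \<le> ?n * l"
      using cubesE[OF Q] by metis
    have Cpos: "C > 0" using K(1) by (simp add: C_def add_pos_pos)
    have lp: "l ^ CARD('n) = l powr ?n" using l by (simp add: powr_realpow)
    show ?thesis
    proof (cases "x = y")
      case True
      then show ?thesis using l Cpos
        by (simp add: em riesz_kernel_0 ennreal_mult_top ennreal_mult_eq_top_iff)
    next
      case False
      define d where "d = norm (x - y)"
      have d: "0 < d" using False by (simp add: d_def)
      have kx: "riesz_kernel t (x - y) = ennreal (d powr (- t))"
        using False by (simp add: riesz_kernel_eq d_def)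
      have rhs: "ennreal C * emeasure lborel Q * riesz_kernel t (x - y)
          = ennreal (C * l powr ?n * d powr (- t))"
        using Cpos unfolding em lp kx by (simp add: ennreal_mult)
      show ?thesis
      proof (cases "d \<le> 2 * ?n * l")
        case near: True
        have "l powr (- t) \<le> (d / (2 * ?n)) powr (- t)"
          using near d l t by (intro powr_mono2') (auto simp: field_simps)
        also have "\<dots> = (2 * ?n) powr t * d powr (- t)"
          using d by (simp add: powr_divide powr_minus_divide)
        finally have "l powr (- t) \<le> (2 * ?n) powr t * d powr (- t)" .
        then have "(K + 1) * l powr ?n * l powr (- t)
            \<le> (K + 1) * l powr ?n * ((2 * ?n) powr t * d powr (- t))"
          using K(1) by (intro mult_left_mono) auto
        also have "\<dots> \<le> C * l powr ?n * d powr (- t)"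
          by (simp add: C_def algebra_simps)
        finally have b: "(K + 1) * l powr ?n * l powr (- t) \<le> C * l powr ?n * d powr (- t)" .
        have "(\<integral>\<^sup>+ z \<in> Q. riesz_kernel t (z - y) \<partial>lborel)
            \<le> ennreal (K * l powr (?n - t)) + ennreal (l powr (- t)) * ennreal (l powr ?n)"
          using K(2)[OF l Qm, of y] by (simp add: em lp)
        also have "\<dots> = ennreal ((K + 1) * l powr ?n * l powr (- t))"
          using K(1) l
          by (simp add: ennreal_mult[symmetric] ennreal_plus[symmetric] powr_diff powr_minus_divide
              field_simps del: ennreal_plus)
        finally show ?thesis unfolding rhs using b by (meson ennreal_leI order_trans)
      next
        case far: False
        have le: "riesz_kernel t (z - y) \<le> ennreal ((d / 2) powr (- t))" if "z \<in> Q" for z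
        proof (rule riesz_kernel_antimono)
          have "norm (x - z) \<le> ?n * l" using diam x that by blast
          then show "d / 2 \<le> norm (z - y)"
            using far norm_triangle_ineq[of "x - z" "z - y"] by (simp add: d_def)
        qed (use d t in auto)
        have "(\<integral>\<^sup>+ z \<in> Q. riesz_kernel t (z - y) \<partial>lborel)
            \<le> (\<integral>\<^sup>+ z \<in> Q. ennreal ((d / 2) powr (- t)) \<partial>lborel)"
          using le by (intro nn_integral_mono) (auto simp: indicator_def)
        also have "\<dots> = ennreal ((d / 2) powr (- t) * l powr ?n)"
          by (simp add: nn_integral_cmult_indicator em lp ennreal_mult)
        also have "\<dots> \<le> ennreal (C * l powr ?n * d powr (- t))"
          using d K(1) by (intro ennreal_leI)
            (simp add: C_def powr_divide powr_minus_divide algebra_simps)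
        finally show ?thesis unfolding rhs .
      qed
    qed
  qed
  moreover have "C > 0" using K(1) by (simp add: C_def add_pos_pos)
  ultimately show ?thesis by blast
qed

section \<open>Jensen's inequality for powers\<close>

text \<open>
  This says that the graph of the convex function \<open>u\<^sup>r\<close> lies above its tangent line at \<open>b\<close>, with the
  negative term moved to the other side so that no subtraction in \<open>ennreal\<close> occurs.
\<close>
lemma young_rpow:
  fixes f :: ennreal and b r :: real
  assumes "1 \<le> r" "0 < b"
  shows "ennreal (r * b powr (r - 1)) * f \<le> ennreal_rpow f r + ennreal ((r - 1) * b powr r)"
proof (cases f)
  case (real x)
  have "r * b powr (r - 1) * x \<le> x powr r + (r - 1) * b powr r"
  proof (cases "x = 0")
    case False
    then have x: "x > 0" using real by simp
    have "x * b powr (r - 1) \<le> (1 / r) * x powr r + (1 - 1 / r) * b powr r"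
      using Youngs_inequality_0[of "1/r" "1 - 1/r" "x powr r" "b powr r"] assms x
      by (simp add: powr_powr right_diff_distrib)
    then have "r * (x * b powr (r - 1)) \<le> r * ((1 / r) * x powr r + (1 - 1 / r) * b powr r)"
      using assms by (intro mult_left_mono) auto
    also have "\<dots> = x powr r + (r - 1) * b powr r" using assms by (simp add: field_simps)
    finally show ?thesis by (simp add: mult_ac)
  qed (use assms in auto)
  then show ?thesis using assms real
    by (simp add: rpow_ennreal ennreal_mult[symmetric] ennreal_plus[symmetric] del: ennreal_plus)
next
  case top
  then show ?thesis using assms rpow_top[of r] by simp
qed

text \<open>
  Integrate the tangent line inequality and choose for \<open>b\<close> the mean value of \<open>f\<close>.
\<close>
lemma rpow_nn_integral_le:
  assumes "finite_measure M" and [measurable]: "f \<in> borel_measurable M" and r: "1 \<le> r"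
  shows "ennreal_rpow (\<integral>\<^sup>+ y. f y \<partial>M) r
    \<le> ennreal_rpow (emeasure M (space M)) (r - 1) * (\<integral>\<^sup>+ y. ennreal_rpow (f y) r \<partial>M)"
    (is "ennreal_rpow ?F r \<le> ennreal_rpow ?m (r - 1) * ?G")
proof -
  interpret finite_measure M by fact
  define m where "m = measure M (space M)"
  have em: "?m = ennreal m" by (simp add: m_def emeasure_eq_measure)
  have int: "ennreal (r * b powr (r - 1)) * ?F \<le> ?G + ennreal ((r - 1) * b powr r * m)"
    if "0 < b" for b
  proof -
    have "ennreal (r * b powr (r - 1)) * ?F = (\<integral>\<^sup>+ y. ennreal (r * b powr (r - 1)) * f y \<partial>M)"
      by (simp add: nn_integral_cmult)
    also have "\<dots> \<le> (\<integral>\<^sup>+ y. ennreal_rpow (f y) r + ennreal ((r - 1) * b powr r) \<partial>M)"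
      using r that by (intro nn_integral_mono young_rpow) auto
    also have "\<dots> = ?G + ennreal ((r - 1) * b powr r * m)"
      using r by (simp add: nn_integral_add em ennreal_mult m_def)
    finally show ?thesis .
  qed
  show ?thesis
  proof (cases "?F = 0 \<or> m = 0")
    case True
    have "?F = 0"
    proof (cases "m = 0")
      case m0: True
      then have "space M \<in> null_sets M" by (auto simp: null_sets_def em)
      then have "AE y in M. f y = 0" by (rule AE_I') auto
      then show ?thesis by (simp add: nn_integral_0_iff_AE)
    qed (use True in simp)
    then show ?thesis using r by (simp add: rpow_0)
  next
    case False
    then have m: "0 < m" unfolding m_def using measure_nonneg[of M] by (simp add: less_le)
    have mr: "ennreal_rpow ?m (r - 1) = ennreal (m powr (r - 1))"
      using m r by (cases "r = 1") (auto simp: em rpow_ennreal ennreal_rpow_def)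
    show ?thesis
    proof (cases ?G)
      case top
      then show ?thesis using m by (simp add: mr ennreal_mult_top)
    next
      case (real g)
      have "?F < \<infinity>"
      proof (rule ccontr)
        assume "\<not> ?F < \<infinity>"
        then have "?F = top" by (simp add: not_less top_unique)
        \<comment> \<open>An infinite left-hand side forces the finite value \<open>g\<close> to be infinite, whatever \<open>b\<close> is.\<close>
        then show False using int[of 1] r real m by (simp add: ennreal_mult_top ennreal_mult_eq_top_iff top_unique)
      qed
      then obtain F where F: "0 \<le> F" "?F = ennreal F" by (cases ?F) auto
      have Fpos: "0 < F" using F False by (auto simp: less_le)
      define b where "b = F / m"
      have b: "0 < b" using Fpos m by (simp add: b_def)
      have young: "r * b powr (r - 1) * F \<le> g + (r - 1) * b powr r * m"
        using int[OF b] F real r b m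
        by (simp add: ennreal_mult[symmetric] ennreal_plus[symmetric] del: ennreal_plus)
      have "r * b powr (r - 1) * F = r * (b powr r * m)"
        using b m Fpos by (simp add: b_def powr_diff)
      with young have "b powr r * m \<le> g" by (simp only:) (simp add: algebra_simps)
      then have "m powr (r - 1) * (b powr r * m) \<le> m powr (r - 1) * g"
        by (intro mult_left_mono) auto
      moreover have "m powr (r - 1) * (b powr r * m) = F powr r"
        using m Fpos by (simp add: b_def powr_diff powr_divide)
      ultimately show ?thesis using r F real m
        by (simp add: mr rpow_ennreal ennreal_mult[symmetric])
    qed
  qed
qed

section \<open>Powers of weights with exponent at most one\<close>

text \<open>
  Let \<open>a = w(x)\<close> be positive and finite. Averaging \<open>w\<^sup>r \<le> a\<^sup>r + a\<^bsup>r-1\<^esup> w\<close> over a cube containing \<open>x\<close>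
  and using that the average of \<open>w\<close> is at most \<open>C a\<close> yields the bound \<open>(1 + C) a\<^sup>r\<close>. If \<open>a = 0\<close>,
  the bound on the average makes \<open>w\<close> vanish almost everywhere on the cube.
\<close>
lemma A1_rpow_le_1:
  fixes w :: "real ^ 'n \<Rightarrow> ennreal"
  assumes w: "w \<in> A1" and r: "0 \<le> r" "r \<le> 1"
  shows "(\<lambda>x. ennreal_rpow (w x) r) \<in> A1"
proof -
  have wm[measurable]: "w \<in> borel_measurable lebesgue"
    and wint: "\<And>K. compact K \<Longrightarrow> (\<integral>\<^sup>+ y \<in> K. w y \<partial>lebesgue) < \<infinity>"
    using w by (auto simp: A1_def weight_def)
  obtain C0 where C0: "AE x in lebesgue. hl_maximal w x \<le> ennreal C0 * w x"
    using w by (auto simp: A1_def)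
  define C where "C = max 0 C0"
  have C: "0 \<le> C" "AE x in lebesgue. hl_maximal w x \<le> ennreal C * w x"
    using C0 unfolding C_def by (auto simp: max_def ennreal_neg)
  have split: "ennreal_rpow f r \<le> ennreal (a powr r) + ennreal (a powr (r - 1)) * f"
    if a: "0 < a" for a f
  proof (cases f)
    case (real u)
    have "u powr r \<le> a powr r + a powr (r - 1) * u" if "0 < u"
    proof (cases "u \<le> a")
      case True
      then have "u powr r \<le> a powr r" using that r by (intro powr_mono2) auto
      then show ?thesis using that by (simp add: add_increasing2)
    next
      case False
      then have "u powr (r - 1) \<le> a powr (r - 1)" using a r by (intro powr_mono2') auto
      then have "u powr (r - 1) * u \<le> a powr (r - 1) * u" using that by (intro mult_right_mono) auto
      then show ?thesis using that by (simp add: powr_diff add_increasing)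
    qed
    then show ?thesis using real r a
      by (cases "r = 0"; cases "u = 0") (auto simp: rpow_ennreal rpow_0 ennreal_mult[symmetric] ennreal_plus[symmetric]
          ennreal_rpow_def[of _ 0] add_increasing2 simp del: ennreal_plus)
  next
    case top
    then show ?thesis using a by (simp add: ennreal_mult_top)
  qed
  have "weight (\<lambda>x. ennreal_rpow (w x) r)"
    unfolding weight_def
  proof (intro conjI allI impI)
    fix K :: "(real ^ 'n) set" assume K: "compact K"
    then have [measurable]: "K \<in> sets lebesgue" by (simp add: borel_compact)
    have "(\<integral>\<^sup>+ y \<in> K. ennreal_rpow (w y) r \<partial>lebesgue)
        \<le> (\<integral>\<^sup>+ y. indicator K y + w y * indicator K y \<partial>lebesgue)"
      using split[of 1] by (intro nn_integral_mono) (auto simp: indicator_def)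
    also have "\<dots> = emeasure lebesgue K + (\<integral>\<^sup>+ y \<in> K. w y \<partial>lebesgue)"
      by (subst nn_integral_add) auto
    also have "\<dots> < \<infinity>"
      using wint[OF K] emeasure_compact_finite[OF K] by (simp add: borel_compact K)
    finally show "(\<integral>\<^sup>+ y \<in> K. ennreal_rpow (w y) r \<partial>lebesgue) < \<infinity>" .
  qed measurable
  moreover have "AE x in lebesgue. hl_maximal (\<lambda>x. ennreal_rpow (w x) r) x
      \<le> ennreal (1 + C) * ennreal_rpow (w x) r"
    using C(2)
  proof eventually_elim
    case (elim x)
    show ?case unfolding hl_maximal_def
    proof (rule SUP_least, clarify)
      fix Q assume Q: "Q \<in> (cubes :: (real ^ 'n) set set)" and x: "x \<in> Q"
      obtain l where l: "0 < l" and Qb: "Q \<in> sets borel"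
        and em: "emeasure lborel Q = ennreal (l ^ CARD('n))"
        using cubesE[OF Q] by metis
      define q where "q = l ^ CARD('n)"
      have q: "0 < q" and eq: "emeasure lebesgue Q = ennreal q"
        using l em Qb by (auto simp: q_def)
      have [measurable]: "Q \<in> sets lebesgue" using Qb by simp
      have "(\<integral>\<^sup>+ y \<in> Q. w y \<partial>lebesgue) / ennreal q \<le> hl_maximal w x"
        unfolding hl_maximal_def eq[symmetric] using Q x by (intro SUP_upper) auto
      then have avg: "(\<integral>\<^sup>+ y \<in> Q. w y \<partial>lebesgue) / ennreal q \<le> ennreal C * w x"
        using elim by (rule order_trans)
      have "(\<integral>\<^sup>+ y \<in> Q. w y \<partial>lebesgue) = (\<integral>\<^sup>+ y \<in> Q. w y \<partial>lebesgue) / ennreal q * ennreal q"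
        using q by (simp add: ennreal_divide_times)
      also have "\<dots> \<le> ennreal C * w x * ennreal q" using avg by (rule mult_right_mono) simp
      finally have int: "(\<integral>\<^sup>+ y \<in> Q. w y \<partial>lebesgue) \<le> ennreal C * w x * ennreal q" .
      have "(\<integral>\<^sup>+ y \<in> Q. ennreal_rpow (w y) r \<partial>lebesgue)
          \<le> ennreal q * (ennreal (1 + C) * ennreal_rpow (w x) r)"
      proof (cases "r = 0")
        case True
        have "ennreal q * 1 \<le> ennreal q * ennreal (1 + C)"
          using C(1) by (intro mult_left_mono) (auto simp: ennreal_leI simp flip: ennreal_1)
        then show ?thesis using True by (simp add: ennreal_rpow_def eq)
      next
        case False
        show ?thesis
        proof (cases "w x")
          case top
          then show ?thesis using False q C(1) rpow_top[of r]
            by (simp add: ennreal_mult_top)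
        next
          case (real a)
          show ?thesis
          proof (cases "a = 0")
            case True
            then have "(\<integral>\<^sup>+ y \<in> Q. w y \<partial>lebesgue) = 0" using int real by simp
            then have "AE y in lebesgue. w y * indicator Q y = 0"
              by (subst (asm) nn_integral_0_iff_AE) auto
            then have "AE y in lebesgue. ennreal_rpow (w y) r * indicator Q y = 0"
              by eventually_elim (use False in \<open>auto simp: rpow_0 indicator_def\<close>)
            then have "(\<integral>\<^sup>+ y \<in> Q. ennreal_rpow (w y) r \<partial>lebesgue) = 0"
              by (subst nn_integral_0_iff_AE) auto
            then show ?thesis by simp
          next
            case a0: False
            then have a: "0 < a" using real by simp
            have "(\<integral>\<^sup>+ y \<in> Q. ennreal_rpow (w y) r \<partial>lebesgue)
                \<le> (\<integral>\<^sup>+ y. ennreal (a powr r) * indicator Q y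
                      + ennreal (a powr (r - 1)) * (w y * indicator Q y) \<partial>lebesgue)"
              using split[OF a] by (intro nn_integral_mono) (auto simp: indicator_def)
            also have "\<dots> = ennreal (a powr r) * ennreal q
                + ennreal (a powr (r - 1)) * (\<integral>\<^sup>+ y \<in> Q. w y \<partial>lebesgue)"
              by (subst nn_integral_add) (auto simp: nn_integral_cmult eq)
            also have "\<dots> \<le> ennreal (a powr r) * ennreal q
                + ennreal (a powr (r - 1)) * (ennreal C * ennreal a * ennreal q)"
              using int real by (intro add_left_mono mult_left_mono) auto
            also have "\<dots> = ennreal (a powr r * q + a powr (r - 1) * (C * a * q))"
              using q a C(1) by (simp add: ennreal_mult)
            also have "a powr r * q + a powr (r - 1) * (C * a * q) = q * ((1 + C) * a powr r)"
              using a by (simp add: powr_diff field_simps)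
            also have "ennreal (q * ((1 + C) * a powr r))
                = ennreal q * (ennreal (1 + C) * ennreal_rpow (w x) r)"
              using False real a q C(1) by (simp add: rpow_ennreal ennreal_mult)
            finally show ?thesis .
          qed
        qed
      qed
      then show "(\<integral>\<^sup>+ y \<in> Q. ennreal_rpow (w y) r \<partial>lebesgue) / emeasure lebesgue Q
          \<le> ennreal (1 + C) * ennreal_rpow (w x) r"
        unfolding eq using q by (intro divide_le_posI_ennreal) auto
    qed
  qed
  ultimately show ?thesis unfolding A1_def by blast
qed

section \<open>Powers of Riesz potentials\<close>

lemma riesz_potential_kernel:
  "riesz_potential \<alpha> \<mu> x = (\<integral>\<^sup>+ y. riesz_kernel (real CARD('n) - \<alpha>) (x - y) \<partial>\<mu>)"
  for \<mu> :: "(real ^ 'n) measure"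
  by (simp add: riesz_potential_def riesz_kernel_def)

text \<open>
  Local integrability comes from Jensen's inequality for \<open>\<mu>\<close> itself. The \<open>A\<^sub>1\<close> bound comes from
  Jensen's inequality for \<open>d\<nu>(y) = k\<^sub>s(x - y) d\<mu>(y)\<close>; this choice is what produces the factor
  \<open>I(x)\<^sup>r\<close> on the right-hand side.
\<close>
lemma riesz_potential_rpow_A1:
  fixes \<mu> :: "(real ^ 'n) measure" and \<alpha> r :: real
  assumes \<alpha>: "\<alpha> < real CARD('n)"
    and fin: "finite_measure \<mu>" and sets[measurable_cong]: "sets \<mu> = sets borel"
    and r: "1 \<le> r" "r * (real CARD('n) - \<alpha>) < real CARD('n)"
  shows "(\<lambda>x. ennreal_rpow (riesz_potential \<alpha> \<mu> x) r) \<in> A1"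
proof -
  interpret \<mu>: finite_measure \<mu> by fact
  interpret \<mu>l: pair_sigma_finite \<mu> lborel ..
  define s where "s = real CARD('n) - \<alpha>"
  define t where "t = s * r"
  have s: "0 < s" using \<alpha> by (simp add: s_def)
  have t: "0 < t" "t < real CARD('n)" using s r by (auto simp: t_def s_def mult.commute)
  define I where "I x = (\<integral>\<^sup>+ y. riesz_kernel s (x - y) \<partial>\<mu>)" for x
  have I: "riesz_potential \<alpha> \<mu> x = I x" for x
    by (simp add: riesz_potential_kernel I_def s_def)
  have Im[measurable]: "I \<in> borel_measurable borel"
    unfolding I_def by measurable
  have rpos: "r > 0" "r \<noteq> 0" using r by auto

  have "(\<integral>\<^sup>+ z \<in> K. ennreal_rpow (I z) r \<partial>lborel) < \<infinity>" if K: "compact K" for K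
  proof -
    obtain C where C: "C > 0" "\<And>(y::real^'n) \<rho> E. 0 < \<rho> \<Longrightarrow> E \<in> sets borel \<Longrightarrow>
      (\<integral>\<^sup>+ z \<in> E. riesz_kernel t (z - y) \<partial>lborel)
        \<le> ennreal (C * \<rho> powr (real CARD('n) - t)) + ennreal (\<rho> powr (- t)) * emeasure lborel E"
      using riesz_kernel_integral_set[where 'a = "real^'n", of t] t by auto
    have [measurable]: "K \<in> sets borel" using K by (simp add: borel_compact)
    let ?m = "emeasure \<mu> (space \<mu>)"
    let ?B = "ennreal C + emeasure lborel K"
    have "(\<integral>\<^sup>+ z \<in> K. ennreal_rpow (I z) r \<partial>lborel)
        \<le> (\<integral>\<^sup>+ z. ennreal_rpow ?m (r - 1) *
              (\<integral>\<^sup>+ y. riesz_kernel t (z - y) * indicator K z \<partial>\<mu>) \<partial>lborel)"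
    proof (rule nn_integral_mono)
      fix z
      have "ennreal_rpow (I z) r \<le> ennreal_rpow ?m (r - 1) * (\<integral>\<^sup>+ y. riesz_kernel t (z - y) \<partial>\<mu>)"
        using rpow_nn_integral_le[OF fin _ r(1), of "\<lambda>y. riesz_kernel s (z - y)"]
        by (simp add: I_def rpow_riesz_kernel rpos t_def)
      then show "ennreal_rpow (I z) r * indicator K z \<le> ennreal_rpow ?m (r - 1) *
              (\<integral>\<^sup>+ y. riesz_kernel t (z - y) * indicator K z \<partial>\<mu>)"
        by (auto simp: indicator_def)
    qed
    also have "\<dots> = ennreal_rpow ?m (r - 1) *
        (\<integral>\<^sup>+ y. (\<integral>\<^sup>+ z \<in> K. riesz_kernel t (z - y) \<partial>lborel) \<partial>\<mu>)"
      by (subst \<mu>l.Fubini'[symmetric]) (auto simp: nn_integral_cmult)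
    also have "\<dots> \<le> ennreal_rpow ?m (r - 1) * (\<integral>\<^sup>+ y. ?B \<partial>\<mu>)"
      using C(2)[of 1 K] by (intro mult_left_mono nn_integral_mono) auto
    also have "\<dots> < \<infinity>"
      using emeasure_compact_finite[OF K]
      by (auto simp: \<mu>.emeasure_eq_measure ennreal_mult_less_top ennreal_rpow_def)
    finally show ?thesis .
  qed
  then have wt: "weight (\<lambda>x. ennreal_rpow (I x) r)"
    unfolding weight_def nn_integral_completion by (auto intro!: measurable_completion)

  obtain C where C: "C > 0" "\<And>Q x (y::real^'n). Q \<in> cubes \<Longrightarrow> x \<in> Q \<Longrightarrow>
    (\<integral>\<^sup>+ z \<in> Q. riesz_kernel t (z - y) \<partial>lborel)
      \<le> ennreal C * emeasure lborel Q * riesz_kernel t (x - y)"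
    using riesz_kernel_cube_average[OF t] by blast
  have avg: "(\<integral>\<^sup>+ z \<in> Q. ennreal_rpow (I z) r \<partial>lborel)
      \<le> emeasure lborel Q * (ennreal C * ennreal_rpow (I x) r)"
    if Q: "Q \<in> cubes" and x: "x \<in> Q" for Q x
  proof (cases "I x = \<infinity>")
    case True
    obtain l where "0 < l" "emeasure lborel Q = ennreal (l ^ CARD('n))"
      using cubesE[OF Q] by metis
    then show ?thesis using True C(1) rpos rpow_top[of r] by (simp add: ennreal_mult_top)
  next
    case False
    have Qm[measurable]: "Q \<in> sets borel" using cubesE[OF Q] by metis
    \<comment> \<open>An atom at \<open>x\<close> would make \<open>I(x)\<close> infinite.\<close>
    have "AE y in \<mu>. riesz_kernel s (x - y) \<noteq> \<infinity>"
      using False unfolding I_def by (intro nn_integral_PInf_AE) auto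
    then have ne: "AE y in \<mu>. y \<noteq> x"
      by eventually_elim (auto simp: riesz_kernel_0)
    define \<nu> where "\<nu> = density \<mu> (\<lambda>y. riesz_kernel s (x - y))"
    have [measurable_cong]: "sets \<nu> = sets borel" by (simp add: \<nu>_def sets)
    have mass: "emeasure \<nu> (space \<nu>) = I x"
      unfolding \<nu>_def I_def by (subst emeasure_density) (auto intro!: nn_integral_cong)
    have \<nu>fin: "finite_measure \<nu>" using mass False by (intro finite_measureI) simp
    interpret \<nu>: finite_measure \<nu> by fact
    interpret \<nu>l: pair_sigma_finite \<nu> lborel ..
    have ne\<nu>: "AE y in \<nu>. y \<noteq> x"
      unfolding \<nu>_def using ne by (subst AE_density) auto
    have step: "ennreal_rpow (I z) r \<le> ennreal_rpow (I x) (r - 1) *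
        (\<integral>\<^sup>+ y. ennreal (norm (x - y) powr t) * riesz_kernel t (z - y) \<partial>\<nu>)" for z
    proof -
      have "I z = (\<integral>\<^sup>+ y. riesz_kernel s (x - y) *
          (ennreal (norm (x - y) powr s) * riesz_kernel s (z - y)) \<partial>\<mu>)"
        unfolding I_def
      proof (rule nn_integral_cong_AE, use ne in eventually_elim)
        fix y assume "y \<noteq> x"
        then have "riesz_kernel s (x - y) * ennreal (norm (x - y) powr s) = 1"
          by (simp add: riesz_kernel_eq ennreal_mult[symmetric] powr_add[symmetric])
        then show "riesz_kernel s (z - y) = riesz_kernel s (x - y) *
            (ennreal (norm (x - y) powr s) * riesz_kernel s (z - y))"
          by (simp add: mult.assoc[symmetric])
      qed
      also have "\<dots> = (\<integral>\<^sup>+ y. ennreal (norm (x - y) powr s) * riesz_kernel s (z - y) \<partial>\<nu>)"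
        unfolding \<nu>_def by (subst nn_integral_density) auto
      finally have "ennreal_rpow (I z) r \<le> ennreal_rpow (I x) (r - 1) *
          (\<integral>\<^sup>+ y. ennreal_rpow (ennreal (norm (x - y) powr s) * riesz_kernel s (z - y)) r \<partial>\<nu>)"
        using rpow_nn_integral_le[OF \<nu>fin _ r(1),
            of "\<lambda>y. ennreal (norm (x - y) powr s) * riesz_kernel s (z - y)"]
        by (simp add: mass)
      also have "(\<integral>\<^sup>+ y. ennreal_rpow (ennreal (norm (x - y) powr s) * riesz_kernel s (z - y)) r \<partial>\<nu>)
          = (\<integral>\<^sup>+ y. ennreal (norm (x - y) powr t) * riesz_kernel t (z - y) \<partial>\<nu>)"
        using ne\<nu> by (intro nn_integral_cong_AE, eventually_elim)
          (simp add: rpow_ennreal_mult rpos rpow_riesz_kernel powr_powr t_def)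
      finally show ?thesis .
    qed
    have "(\<integral>\<^sup>+ z \<in> Q. ennreal_rpow (I z) r \<partial>lborel)
        \<le> (\<integral>\<^sup>+ z. ennreal_rpow (I x) (r - 1) * (\<integral>\<^sup>+ y. ennreal (norm (x - y) powr t) *
              (riesz_kernel t (z - y) * indicator Q z) \<partial>\<nu>) \<partial>lborel)"
      using step by (intro nn_integral_mono) (auto simp: indicator_def)
    also have "\<dots> = ennreal_rpow (I x) (r - 1) * (\<integral>\<^sup>+ y. ennreal (norm (x - y) powr t) *
              (\<integral>\<^sup>+ z \<in> Q. riesz_kernel t (z - y) \<partial>lborel) \<partial>\<nu>)"
      by (subst nn_integral_cmult, measurable, subst \<nu>l.Fubini', measurable)
        (simp add: nn_integral_cmult)
    also have "\<dots> \<le> ennreal_rpow (I x) (r - 1) * (\<integral>\<^sup>+ y. ennreal C * emeasure lborel Q \<partial>\<nu>)"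
    proof (rule mult_left_mono, rule nn_integral_mono_AE, use ne\<nu> in eventually_elim)
      fix y assume y: "y \<noteq> x"
      have "ennreal (norm (x - y) powr t) * (\<integral>\<^sup>+ z \<in> Q. riesz_kernel t (z - y) \<partial>lborel)
          \<le> ennreal (norm (x - y) powr t) *
            (ennreal C * emeasure lborel Q * riesz_kernel t (x - y))"
        using C(2)[OF Q x] by (intro mult_left_mono) auto
      also have "\<dots> = ennreal C * emeasure lborel Q *
          (ennreal (norm (x - y) powr t) * riesz_kernel t (x - y))"
        by (simp add: mult_ac)
      also have "ennreal (norm (x - y) powr t) * riesz_kernel t (x - y) = 1"
        using y by (simp add: riesz_kernel_eq ennreal_mult[symmetric] powr_add[symmetric])
      finally show "ennreal (norm (x - y) powr t) * (\<integral>\<^sup>+ z \<in> Q. riesz_kernel t (z - y) \<partial>lborel)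
          \<le> ennreal C * emeasure lborel Q" by simp
    qed simp
    also have "\<dots> = emeasure lborel Q * (ennreal C * (ennreal_rpow (I x) (r - 1) * I x))"
      by (simp add: mass mult_ac)
    also have "ennreal_rpow (I x) (r - 1) * I x = ennreal_rpow (I x) r"
      using False r by (intro rpow_diff_mult) (auto simp: less_top)
    finally show ?thesis .
  qed
  have "hl_maximal (\<lambda>x. ennreal_rpow (I x) r) x \<le> ennreal C * ennreal_rpow (I x) r" for x
    unfolding hl_maximal_def
  proof (rule SUP_least, clarify)
    fix Q assume Q: "Q \<in> (cubes :: (real ^ 'n) set set)" and x: "x \<in> Q"
    obtain l where "0 < l" "Q \<in> sets borel" "emeasure lborel Q = ennreal (l ^ CARD('n))"
      using cubesE[OF Q] by metis
    then show "(\<integral>\<^sup>+ y \<in> Q. ennreal_rpow (I y) r \<partial>lebesgue) / emeasure lebesgue Q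
        \<le> ennreal C * ennreal_rpow (I x) r"
      using avg[OF Q x] by (intro divide_le_posI_ennreal) (auto simp: nn_integral_completion)
  qed
  with wt show ?thesis unfolding A1_def I by auto
qed

theorem lemma1p7:
  fixes \<mu> :: "(real ^ 'n) measure" and \<alpha> r :: real
  assumes "CARD('n) \<ge> 2"
    and "0 < \<alpha>" and "\<alpha> < real CARD('n)"
    and "finite_measure \<mu>" and "sets \<mu> = sets borel"
    and "0 \<le> r" and "r < real CARD('n) / (real CARD('n) - \<alpha>)"
  shows "(\<lambda>x. ennreal_rpow (riesz_potential \<alpha> \<mu> x) r) \<in> A1"
proof (cases "1 \<le> r")
  case True
  then show ?thesis
    using assms by (intro riesz_potential_rpow_A1) (auto simp: field_simps)
next
  case False
  have "(\<lambda>x. ennreal_rpow (riesz_potential \<alpha> \<mu> x) 1) \<in> A1"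
    using assms by (intro riesz_potential_rpow_A1) auto
  then show ?thesis
    using A1_rpow_le_1[of "riesz_potential \<alpha> \<mu>" r] assms False by simp
qed

end
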